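(* Let $(\varepsilon_i)_{i\ge 1}$ be independent identically distributed random variables with $\mathbf{P}\{\varepsilon_i=0\}=\mathbf{P}\{\varepsilon_i=1\}=\tfrac12$, and let $S_n=\varepsilon_1+\dots+\varepsilon_n$. There exist a real-valued function $E(n,d)$, defined for all integers $n\ge d\ge 2$, and an absolute constant $C>0$ such that for every integer $n\ge 2$ $$\sup_{2\le d\le n}\big|\mathbf{P}\{d\mid S_n\}-E(n,d)\big|\le C\,\frac{\log^{5/2} n}{n^{3/2}},$$ where the supremum is over integers $d$, and such that for all integers $n\ge d\ge 2$ $$\frac{1}{2\sqrt{2\pi}}\le \frac{E(n,d)}{\max\big(\frac{1}{2d},\frac{1}{\sqrt n}\big)\Big[e^{-\frac{r_d(n)^2}{2n}}+e^{-\frac{\bar r_d(n)^2}{2n}}\Big]}\le \frac{32}{\sqrt{2\pi}}.$$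
   Context: For integers $n\ge d\ge 2$, $r_d(n)$ denotes the least residue of $n$ modulo $2d$, i.e. the unique integer $r$ with $0\le r<2d$ and $n\equiv r \pmod{2d}$, and $\bar r_d(n)=2d-r_d(n)$. The notation $d\mid S_n$ means that the integer $d$ divides the integer $S_n$ (with $d\mid 0$ true). *)

theory Defs
  imports "HOL-Probability.Probability"
begin

text \<open>
  The two point masses sum to 1, so they determine the common law of the variables;
  identical distribution therefore needs no separate clause, and each variable takes
  values in \<open>{0, 1}\<close> almost surely. Membership in the independent family includes measurability.
\<close>

definition iid_fair_bits :: "'a measure \<Rightarrow> (nat \<Rightarrow> 'a \<Rightarrow> int) \<Rightarrow> bool" where
  "iid_fair_bits M \<epsilon> \<longleftrightarrow>
     prob_space M \<and>
     prob_space.indep_vars M (\<lambda>_. count_space UNIV) \<epsilon> {1..} \<and>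
     (\<forall>i\<ge>1. measure M {\<omega> \<in> space M. \<epsilon> i \<omega> = 0} = 1 / 2 \<and>
            measure M {\<omega> \<in> space M. \<epsilon> i \<omega> = 1} = 1 / 2)"

definition partial_sum :: "(nat \<Rightarrow> 'a \<Rightarrow> int) \<Rightarrow> nat \<Rightarrow> 'a \<Rightarrow> int" where
  "partial_sum \<epsilon> n \<omega> = (\<Sum>i = 1..n. \<epsilon> i \<omega>)"

definition res :: "nat \<Rightarrow> nat \<Rightarrow> nat" where
  "res d n = n mod (2 * d)"

text \<open>The truncated subtraction below is exact for \<open>d > 0\<close>, since then \<open>res d n < 2 * d\<close>.\<close>

definition co_res :: "nat \<Rightarrow> nat \<Rightarrow> nat" where
  "co_res d n = 2 * d - res d n"

end

theory Submission
  imports Defs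
begin

text \<open>
  Let \<open>p k\<close> be the probability of \<open>S\<^sub>n = k\<close>, let \<open>P\<close> be the probability of \<open>d\<close> dividing \<open>S\<^sub>n\<close>, and let
  \<open>X\<close> be the denominator of the ratio in the theorem, called the envelope below. The function \<open>E\<close> may
  be chosen freely, so it is enough to compare \<open>P\<close> with \<open>X\<close>. If

    \<open>P \<le> 8 X\<close>  and  \<open>P \<ge> X / 4 - O(1 / (n sqrt n))\<close>,

  then \<open>E = max (l X) P\<close> with \<open>l = 1 / (2 sqrt (2 pi)) \<le> 1 / 4\<close> lies between \<open>l X\<close> and \<open>8 X\<close>, where
  \<open>8 \<le> 32 / sqrt (2 pi)\<close>, and it differs from \<open>P\<close> by no more than the error term. The exact
  probability itself would not do: for \<open>d = n\<close> it is \<open>2\<close> divided by \<open>2\<close> to the power \<open>n\<close>, which is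
  exponentially smaller than the Gaussian terms \<open>exp (- n / 2)\<close> in \<open>X\<close>.

  Both comparisons rest on elementary bounds for the single masses. With \<open>m = 2 k - n\<close> and
  \<open>y = (m + 1) / (n + 1)\<close>, the quotient of \<open>p (k + 1)\<close> by \<open>p k\<close> is \<open>(1 - y) / (1 + y)\<close>, which is close to
  \<open>exp (- 2 y)\<close>, the corresponding quotient for a Gaussian in \<open>m\<close>. Multiplying such quotients,
  starting from a Wallis estimate for the central mass, gives the upper bound
  \<open>fair_binom_gaussian_upper\<close> for all \<open>k\<close> and the lower bound \<open>fair_binom_gaussian_lower\<close> up to an error.

  For the upper bound (\<open>fair_binom_dvd_le_envelope\<close>) the Gaussians are summed over all multiples of
  \<open>d\<close>. Their deviations \<open>\<bar>2 k - n\<bar>\<close> form two arithmetic progressions of step \<open>2 d\<close>, starting at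
  the residue and at the complementary residue, and each sum is at most its first term times
  \<open>O(1 + sqrt n / d)\<close>.

  For the lower bound (\<open>fair_binom_dvd_ge_envelope\<close>) there are two regimes. If \<open>2 d > sqrt n\<close>, then the
  first terms of the two progressions suffice. If \<open>2 d \<le> sqrt n\<close>, then unimodality of the binomial
  distribution gives \<open>P \<ge> 1 / d - max p \<ge> 1 / (2 d)\<close>, while \<open>X \<le> 1 / d\<close>.
\<close>

section \<open>The law of the partial sums\<close>

definition fair_binom :: "nat \<Rightarrow> nat \<Rightarrow> real" where
  "fair_binom n k = real (n choose k) / 2 ^ n"

text \<open>
  The bound \<open>j \<le> n\<close> loses no multiple of \<open>d \<ge> 1\<close> with positive mass, and a range that does not
  depend on \<open>d\<close> keeps the reindexings below simple.
\<close>
definition fair_binom_dvd :: "nat \<Rightarrow> nat \<Rightarrow> real" where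
  "fair_binom_dvd n d = (\<Sum>j\<le>n. fair_binom n (d * j))"

lemma fair_binom_nonneg [simp]: "0 \<le> fair_binom n k"
  by (simp add: fair_binom_def)

lemma fair_binom_eq_0: "n < k \<Longrightarrow> fair_binom n k = 0"
  by (simp add: fair_binom_def)

lemma fair_binom_symmetric: "k \<le> n \<Longrightarrow> fair_binom n k = fair_binom n (n - k)"
  using binomial_symmetric[of k n] by (simp add: fair_binom_def)

lemma sum_fair_binom: "(\<Sum>k\<le>n. fair_binom n k) = 1"
proof -
  have "(\<Sum>k\<le>n. fair_binom n k) = real (\<Sum>k\<le>n. n choose k) / 2 ^ n"
    by (simp add: fair_binom_def sum_divide_distrib)
  then show ?thesis
    by (simp add: choose_row_sum)
qed

lemma fair_binom_Suc_Suc: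
  "fair_binom (Suc n) (Suc k) = (fair_binom n k + fair_binom n (Suc k)) / 2"
  by (simp add: fair_binom_def field_simps)

lemma fair_binom_Suc_0: "fair_binom (Suc n) 0 = fair_binom n 0 / 2"
  by (simp add: fair_binom_def)

text \<open>
  All estimates of the masses below come from this ratio of neighbouring binomial coefficients.
\<close>
lemma fair_binom_step:
  "(real k + 1) * fair_binom n (Suc k) = (real n - real k) * fair_binom n k"
proof -
  have "real (Suc n * (n choose k)) = real ((Suc n choose Suc k) * Suc k)"
    by (simp only: Suc_times_binomial_eq)
  then have "(real k + 1) * real (n choose Suc k) = (real n - real k) * real (n choose k)"
    by (simp add: algebra_simps)
  then show ?thesis
    by (simp add: fair_binom_def)
qed

text \<open>
  Conditioning on the last bit turns Pascal's rule into the recursion for the law of the partial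
  sums. The claim ranges over all integers \<open>z\<close> so that the induction can pass from \<open>0\<close> to \<open>-1\<close>,
  where the mass is zero.
\<close>
lemma prob_partial_sum_eq:
  assumes bits: "iid_fair_bits M \<epsilon>"
  shows "partial_sum \<epsilon> n \<in> measurable M (count_space UNIV)"
    and "measure M {\<omega> \<in> space M. partial_sum \<epsilon> n \<omega> = z} =
           (if z < 0 then 0 else fair_binom n (nat z))"
proof -
  interpret prob_space M
    using bits by (simp add: iid_fair_bits_def)
  define X where "X = (\<lambda>i \<omega>. real_of_int (\<epsilon> i \<omega>))"
  have half: "prob {\<omega> \<in> space M. \<epsilon> i \<omega> = 0} = 1 / 2" "prob {\<omega> \<in> space M. \<epsilon> i \<omega> = 1} = 1 / 2"
    if "1 \<le> i" for i
    using bits that by (auto simp: iid_fair_bits_def)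
  have "indep_vars (\<lambda>_. count_space UNIV) \<epsilon> {1..}"
    using bits by (simp add: iid_fair_bits_def)
  then have indep: "indep_vars (\<lambda>_. borel) X {1..}"
    unfolding X_def by (rule indep_vars_compose2) auto
  have X_meas [measurable]: "X i \<in> borel_measurable M" if "1 \<le> i" for i
    using indep that by (auto simp: indep_vars_def)
  have sum_eq: "partial_sum \<epsilon> n = (\<lambda>\<omega>. \<lfloor>\<Sum>i\<in>{1..n}. X i \<omega>\<rfloor>)" for n
    by (auto simp: partial_sum_def X_def simp flip: of_int_sum)
  have S_meas [measurable]: "partial_sum \<epsilon> n \<in> measurable M (count_space UNIV)" for n
    unfolding sum_eq by measurable
  then show "partial_sum \<epsilon> n \<in> measurable M (count_space UNIV)" .
  have \<epsilon>_meas [measurable]: "\<epsilon> i \<in> measurable M (count_space UNIV)" if "1 \<le> i" for i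
    using bits that by (auto simp: iid_fair_bits_def indep_vars_def)
  show "measure M {\<omega> \<in> space M. partial_sum \<epsilon> n \<omega> = z} =
          (if z < 0 then 0 else fair_binom n (nat z))"
  proof (induction n arbitrary: z)
    case 0
    show ?case
      by (cases "z = 0") (auto simp: partial_sum_def fair_binom_def prob_space)
  next
    case (Suc n)
    let ?\<epsilon> = "\<epsilon> (Suc n)" and ?S = "partial_sum \<epsilon> n"
    have [measurable]: "?\<epsilon> \<in> measurable M (count_space UNIV)"
      by (rule \<epsilon>_meas) simp
    have "indep_var borel (X (Suc n)) borel (\<lambda>\<omega>. \<Sum>i\<in>{1..n}. X i \<omega>)"
      by (rule indep_vars_sum) (auto intro: indep_vars_subset[OF indep])
    note prod = indep_varD[OF this]
    have joint: "prob {\<omega> \<in> space M. ?\<epsilon> \<omega> = b \<and> ?S \<omega> = w} =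
        1 / 2 * prob {\<omega> \<in> space M. ?S \<omega> = w}" if "b = 0 \<or> b = 1" for b w :: int
    proof -
      have "prob {\<omega> \<in> space M. ?\<epsilon> \<omega> = b \<and> ?S \<omega> = w} =
          prob {\<omega> \<in> space M. ?\<epsilon> \<omega> = b} * prob {\<omega> \<in> space M. ?S \<omega> = w}"
        using prod[of "{real_of_int b}" "{real_of_int w}"]
        by (simp add: X_def partial_sum_def vimage_def Int_def conj_commute flip: of_int_sum)
      also have "prob {\<omega> \<in> space M. ?\<epsilon> \<omega> = b} = 1 / 2"
        using that half[of "Suc n"] by auto
      finally show ?thesis .
    qed
    have "prob {\<omega> \<in> space M. ?\<epsilon> \<omega> = 0 \<or> ?\<epsilon> \<omega> = 1} =
        prob ({\<omega> \<in> space M. ?\<epsilon> \<omega> = 0} \<union> {\<omega> \<in> space M. ?\<epsilon> \<omega> = 1})"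
      by (rule arg_cong[where f = prob]) auto
    also have "\<dots> = 1"
      using half[of "Suc n"] by (subst finite_measure_Union) auto
    finally have "AE \<omega> in M. ?\<epsilon> \<omega> = 0 \<or> ?\<epsilon> \<omega> = 1"
      by (subst (asm) prob_Collect_eq_1) auto
    moreover have "partial_sum \<epsilon> (Suc n) \<omega> = ?S \<omega> + ?\<epsilon> \<omega>" for \<omega>
      by (simp add: partial_sum_def)
    ultimately have "prob {\<omega> \<in> space M. partial_sum \<epsilon> (Suc n) \<omega> = z} =
        prob ({\<omega> \<in> space M. ?\<epsilon> \<omega> = 0 \<and> ?S \<omega> = z} \<union> {\<omega> \<in> space M. ?\<epsilon> \<omega> = 1 \<and> ?S \<omega> = z - 1})"
      by (intro finite_measure_eq_AE) auto
    also have "\<dots> = prob {\<omega> \<in> space M. ?\<epsilon> \<omega> = 0 \<and> ?S \<omega> = z} +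
        prob {\<omega> \<in> space M. ?\<epsilon> \<omega> = 1 \<and> ?S \<omega> = z - 1}"
      by (rule finite_measure_Union) auto
    also have "\<dots> = (if z < 0 then 0 else fair_binom (Suc n) (nat z))"
    proof -
      consider "z < 0" | "z = 0" | k where "z = int (Suc k)"
        by (cases z rule: int_cases) (auto, metis not0_implies_Suc of_nat_0 of_nat_Suc add.commute)
      then show ?thesis
      proof cases
        case 3
        then have "nat z = Suc k" "nat (z - 1) = k" "\<not> z < 0" "\<not> z - 1 < 0"
          by auto
        then show ?thesis
          by (simp add: joint Suc.IH fair_binom_Suc_Suc)
      qed (auto simp: joint Suc.IH fair_binom_Suc_0)
    qed
    finally show ?case .
  qed
qed

lemma prob_dvd_partial_sum:
  assumes bits: "iid_fair_bits M \<epsilon>" and "1 \<le> d"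
  shows "measure M {\<omega> \<in> space M. int d dvd partial_sum \<epsilon> n \<omega>} = fair_binom_dvd n d"
proof -
  interpret prob_space M
    using bits by (simp add: iid_fair_bits_def)
  let ?S = "partial_sum \<epsilon> n"
  note prob_partial_sum_eq(1)[OF bits, measurable]
  have prob_S: "prob {\<omega> \<in> space M. ?S \<omega> = int k} = fair_binom n k" for k
    by (simp add: prob_partial_sum_eq(2)[OF bits])
  have Un: "prob (\<Union>j\<in>{..n}. {\<omega> \<in> space M. ?S \<omega> = int (c * j)}) = fair_binom_dvd n c"
    if "1 \<le> c" for c
    unfolding fair_binom_dvd_def prob_S[symmetric]
    using that by (intro finite_measure_finite_Union) (auto simp: disjoint_family_on_def)
  have "prob {\<omega> \<in> space M. \<exists>j\<le>n. ?S \<omega> = int j} = prob (\<Union>j\<in>{..n}. {\<omega> \<in> space M. ?S \<omega> = int (1 * j)})"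
    by (rule arg_cong[where f = prob]) auto
  also have "\<dots> = 1"
    by (subst Un) (simp_all add: fair_binom_dvd_def sum_fair_binom)
  finally have "AE \<omega> in M. \<exists>j\<le>n. ?S \<omega> = int j"
    by (subst (asm) prob_Collect_eq_1) auto
  then have "prob {\<omega> \<in> space M. int d dvd ?S \<omega>} = prob (\<Union>j\<in>{..n}. {\<omega> \<in> space M. ?S \<omega> = int (d * j)})"
  proof (intro finite_measure_eq_AE, eventually_elim)
    case (elim \<omega>)
    then obtain m where m: "m \<le> n" "?S \<omega> = int m"
      by auto
    have "d dvd m \<longleftrightarrow> (\<exists>j\<le>n. m = d * j)"
    proof
      assume "d dvd m"
      then obtain j where "m = d * j" by auto
      moreover have "j \<le> d * j" using \<open>1 \<le> d\<close> by simp
      ultimately show "\<exists>j\<le>n. m = d * j"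
        using \<open>m \<le> n\<close> by (intro exI[of _ j]) linarith
    qed auto
    then show ?case
      using m(2) by (auto simp: int_dvd_int_iff simp flip: of_nat_mult)
  qed auto
  with Un[OF \<open>1 \<le> d\<close>] show ?thesis
    by simp
qed

section \<open>The size of the central binomial mass\<close>

definition mode_prob :: "nat \<Rightarrow> real" where
  "mode_prob n = fair_binom n (n div 2)"

lemma mode_prob_even_Suc:
  "2 * (real h + 1) * mode_prob (2 * Suc h) = (2 * real h + 1) * mode_prob (2 * h)"
proof -
  have "fair_binom (2 * h + 1) h = fair_binom (2 * h + 1) (Suc h)"
    by (subst fair_binom_symmetric) auto
  then have "mode_prob (2 * Suc h) = fair_binom (2 * h + 1) (Suc h)"
    using fair_binom_Suc_Suc[of "2 * h + 1" h] by (simp add: mode_prob_def)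
  moreover have "(real h + 1) * fair_binom (2 * h) (Suc h) = real h * mode_prob (2 * h)"
    using fair_binom_step[of h "2 * h"] by (simp add: mode_prob_def)
  ultimately show ?thesis
    using fair_binom_Suc_Suc[of "2 * h" h] by (simp add: mode_prob_def field_simps)
qed

lemma mode_prob_odd: "mode_prob (2 * h + 1) = mode_prob (2 * h + 2)"
proof -
  have "fair_binom (2 * h + 1) h = fair_binom (2 * h + 1) (Suc h)"
    by (subst fair_binom_symmetric) auto
  then show ?thesis
    using fair_binom_Suc_Suc[of "2 * h + 1" h] by (simp add: mode_prob_def)
qed

text \<open>
  This and the next lemma are the two halves of the Wallis estimate. With \<open>x\<close> and \<open>y\<close> the central
  masses for \<open>2 h\<close> and \<open>2 h + 2\<close>, one has \<open>2 (h + 1) y = (2 h + 1) x\<close>, so the claims propagate because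
  of \<open>(2 h + 1) (2 h + 3) \<le> 4 (h + 1)\<^sup>2\<close> and \<open>4 h (h + 1) \<le> (2 h + 1)\<^sup>2\<close> respectively.
\<close>
lemma mode_prob_even_upper: "(2 * real h + 1) * (mode_prob (2 * h))\<^sup>2 \<le> 1"
proof (induction h)
  case 0
  then show ?case by (simp add: mode_prob_def fair_binom_def)
next
  case (Suc h)
  let ?x = "mode_prob (2 * h)" and ?y = "mode_prob (2 * Suc h)"
  have "4 * (real h + 1)\<^sup>2 * ?y\<^sup>2 = (2 * real h + 1)\<^sup>2 * ?x\<^sup>2"
    using mode_prob_even_Suc[of h] by algebra
  then have "4 * (real h + 1)\<^sup>2 * ((2 * real h + 3) * ?y\<^sup>2) =
      (2 * real h + 3) * (2 * real h + 1) * ((2 * real h + 1) * ?x\<^sup>2)"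
    by algebra
  also have "\<dots> \<le> (2 * real h + 3) * (2 * real h + 1) * 1"
    by (intro mult_left_mono Suc.IH) auto
  also have "\<dots> \<le> 4 * (real h + 1)\<^sup>2 * 1"
    by (simp add: power2_eq_square algebra_simps)
  finally show ?case
    by (subst (asm) mult_le_cancel_left_pos) (auto simp: algebra_simps)
qed

lemma mode_prob_even_lower: "1 \<le> 4 * real (Suc h) * (mode_prob (2 * Suc h))\<^sup>2"
proof (induction h)
  case 0
  then show ?case by (simp add: mode_prob_def fair_binom_def power2_eq_square)
next
  case (Suc h)
  let ?x = "mode_prob (2 * Suc h)" and ?y = "mode_prob (2 * Suc (Suc h))" and ?t = "real (Suc h)"
  have sq: "4 * (?t + 1)\<^sup>2 * ?y\<^sup>2 = (2 * ?t + 1)\<^sup>2 * ?x\<^sup>2"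
    using mode_prob_even_Suc[of "Suc h"] by algebra
  have "4 * ?t * (?t + 1) * 1 \<le> 4 * ?t * (?t + 1) * (4 * ?t * ?x\<^sup>2)"
    by (intro mult_left_mono Suc.IH) auto
  also have "\<dots> \<le> 4 * ?t * ((2 * ?t + 1)\<^sup>2 * ?x\<^sup>2)"
  proof -
    have "4 * ?t * (?t + 1) \<le> (2 * ?t + 1)\<^sup>2"
      by (simp add: power2_eq_square algebra_simps)
    then have "4 * ?t * (?t + 1) * (4 * ?t * ?x\<^sup>2) \<le> (2 * ?t + 1)\<^sup>2 * (4 * ?t * ?x\<^sup>2)"
      by (rule mult_right_mono) simp
    then show ?thesis
      by (simp only: mult_ac)
  qed
  also have "\<dots> = 4 * ?t * (?t + 1) * (4 * (?t + 1) * ?y\<^sup>2)"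
    unfolding sq[symmetric] by (simp only: power2_eq_square mult_ac)
  finally have "1 \<le> 4 * (?t + 1) * ?y\<^sup>2"
    by (subst (asm) mult_le_cancel_left_pos) auto
  then show ?case
    by (simp add: algebra_simps)
qed

text \<open>
  An odd index \<open>2 h + 1\<close> has the same central mass as \<open>2 h + 2\<close>, so the even case decides both
  parities.
\<close>
lemma mode_prob_upper:
  assumes "1 \<le> n"
  shows "mode_prob n \<le> 1 / sqrt (real n)"
proof -
  have "real n * (mode_prob n)\<^sup>2 \<le> 1"
  proof (cases "even n")
    case True
    then obtain h where [simp]: "n = 2 * h" by auto
    have "real n * (mode_prob n)\<^sup>2 \<le> (2 * real h + 1) * (mode_prob (2 * h))\<^sup>2"
      by (simp add: mult_right_mono)
    with mode_prob_even_upper[of h] show ?thesis by linarith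
  next
    case False
    then obtain h where [simp]: "n = 2 * h + 1" by (rule oddE)
    have "real n * (mode_prob n)\<^sup>2 \<le> (2 * real (Suc h) + 1) * (mode_prob (2 * Suc h))\<^sup>2"
      using mode_prob_odd[of h] by (simp add: mult_right_mono)
    with mode_prob_even_upper[of "Suc h"] show ?thesis by linarith
  qed
  then have "(mode_prob n)\<^sup>2 \<le> (1 / sqrt (real n))\<^sup>2"
    using assms by (simp add: power_divide field_simps)
  then show ?thesis
    by (rule power2_le_imp_le) simp
qed

text \<open>
  The Wallis estimate gives \<open>2 (n + 1)\<close> under the root for odd \<open>n\<close> and \<open>2 n\<close> for even \<open>n\<close>; the factor
  \<open>3\<close> covers both from \<open>n = 2\<close> on.
\<close>
lemma mode_prob_lower:
  assumes "2 \<le> n"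
  shows "1 / sqrt (3 * real n) \<le> mode_prob n"
proof -
  have "1 \<le> 3 * real n * (mode_prob n)\<^sup>2"
  proof (cases "even n")
    case True
    with assms obtain h where [simp]: "n = 2 * Suc h"
      by (metis dvd_def mult_0_right not0_implies_Suc not_numeral_le_zero)
    have "4 * real (Suc h) * (mode_prob (2 * Suc h))\<^sup>2 \<le> 3 * real n * (mode_prob n)\<^sup>2"
      by (simp add: mult_right_mono)
    with mode_prob_even_lower[of h] show ?thesis by linarith
  next
    case False
    then obtain h where n: "n = 2 * h + 1" by (rule oddE)
    have "4 * real (Suc h) * (mode_prob (2 * Suc h))\<^sup>2 \<le> 3 * real n * (mode_prob n)\<^sup>2"
      using assms mode_prob_odd[of h] n by (simp add: mult_right_mono)
    with mode_prob_even_lower[of h] show ?thesis by linarith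
  qed
  then have "(1 / sqrt (3 * real n))\<^sup>2 \<le> (mode_prob n)\<^sup>2"
    using assms by (simp add: power_divide field_simps)
  then show ?thesis
    by (rule power2_le_imp_le) (simp add: mode_prob_def)
qed

section \<open>Comparison of single masses with a Gaussian\<close>

text \<open>
  This is \<open>(1 - y) / (1 + y) \<le> exp (- 2 y)\<close>, that is \<open>tanh y \<le> y\<close>: the ratio of neighbouring binomial
  masses is at most the corresponding Gaussian ratio. The difference of the two sides, divided by
  \<open>exp y\<close>, vanishes at \<open>0\<close> and has derivative \<open>y (exp y - exp (- y)) \<ge> 0\<close>.
\<close>
lemma exp_double_mult_one_minus_le:
  fixes y :: real
  assumes "0 \<le> y"
  shows "(1 - y) * exp (2 * y) \<le> 1 + y"
proof -
  define f where "f = (\<lambda>y::real. (1 + y) * exp (- y) - (1 - y) * exp y)"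
  have "f 0 \<le> f y"
  proof (rule DERIV_nonneg_imp_nondecreasing[OF assms])
    fix x :: real
    assume "0 \<le> x" "x \<le> y"
    have "(f has_real_derivative x * (exp x - exp (- x))) (at x)"
      unfolding f_def by (auto intro!: derivative_eq_intros simp: algebra_simps)
    moreover have "0 \<le> x * (exp x - exp (- x))"
      using \<open>0 \<le> x\<close> by (intro mult_nonneg_nonneg) auto
    ultimately show "\<exists>D. (f has_real_derivative D) (at x) \<and> 0 \<le> D"
      by blast
  qed
  then have "(1 - y) * exp y \<le> (1 + y) * exp (- y)"
    by (simp add: f_def)
  then have "(1 - y) * exp y * exp y \<le> (1 + y) * exp (- y) * exp y"
    by (rule mult_right_mono) simp
  then show ?thesis
    by (simp add: mult.assoc flip: exp_add)
qed

text \<open>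
  The converse comparison, for which the exponent has to be enlarged by the factor \<open>1 + 2 y\<close>. It is
  the inequality \<open>1 + t \<le> exp t\<close> at \<open>t = 2 y / (1 - y)\<close>.
\<close>
lemma one_plus_le_exp_mult_one_minus:
  fixes y :: real
  assumes "0 \<le> y" "y \<le> 1 / 2"
  shows "1 + y \<le> (1 - y) * exp (2 * y * (1 + 2 * y))"
proof -
  have "(1 + y) / (1 - y) = 1 + 2 * y / (1 - y)"
    using assms by (simp add: field_simps)
  also have "\<dots> \<le> exp (2 * y / (1 - y))"
    by (rule exp_ge_add_one_self)
  also have "2 * y / (1 - y) \<le> 2 * y * (1 + 2 * y)"
  proof -
    have "0 \<le> y * (y * (1 - 2 * y))"
      using assms by simp
    then show ?thesis
      using assms by (simp add: field_simps)
  qed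
  finally show ?thesis
    using assms by (simp add: field_simps)
qed

text \<open>
  In terms of \<open>y\<close>, the ratio of neighbouring masses is \<open>(1 - y) / (1 + y)\<close>, and the weight
  \<open>exp (m\<^sup>2 / (2 (n + 1)))\<close> with \<open>m = 2 k - n\<close> grows by the factor \<open>exp (2 y)\<close> in the same step.
  The two exponential inequalities above are made for this pair.
\<close>
lemma fair_binom_step_normalised:
  fixes n k :: nat
  defines "y \<equiv> (2 * real k + 1 - real n) / (real n + 1)"
  shows "(1 + y) * fair_binom n (Suc k) = (1 - y) * fair_binom n k"
proof -
  have "1 + y = 2 * (real k + 1) / (real n + 1)" "1 - y = 2 * (real n - real k) / (real n + 1)"
    by (simp_all add: y_def field_simps)
  then have "(1 + y) * fair_binom n (Suc k) = 2 / (real n + 1) * ((real k + 1) * fair_binom n (Suc k))"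
    "(1 - y) * fair_binom n k = 2 / (real n + 1) * ((real n - real k) * fair_binom n k)"
    by simp_all
  then show ?thesis
    by (simp only: fair_binom_step)
qed

lemma gaussian_weight_step:
  fixes n k :: nat and a :: real
  defines "y \<equiv> (2 * real k + 1 - real n) / (real n + 1)"
  shows "exp (a * (2 * real (Suc k) - real n)\<^sup>2 / (2 * (real n + 1))) =
    exp (a * (2 * real k - real n)\<^sup>2 / (2 * (real n + 1))) * exp (2 * y * a)"
proof -
  have "(2 * real (Suc k) - real n)\<^sup>2 = (2 * real k - real n)\<^sup>2 + 4 * (2 * real k + 1 - real n)"
    by (simp add: power2_eq_square algebra_simps)
  moreover have "a * (M + 4 * u) / (2 * (real n + 1)) = a * M / (2 * (real n + 1)) + 2 * (u / (real n + 1)) * a"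
    for M u :: real
    by (simp add: add_divide_distrib distrib_left) (simp add: divide_simps)
  ultimately show ?thesis
    by (simp only: y_def exp_add)
qed

text \<open>
  Multiplied by the inverse of a Gaussian of variance \<open>n + 1\<close>, the masses decrease to the right of
  the mode. The factor on the right accounts for odd \<open>n\<close>, where the mode sits at \<open>m = -1\<close>.
\<close>
lemma fair_binom_upper_half:
  assumes "n div 2 \<le> k" "k \<le> n"
  shows "fair_binom n k * exp ((2 * real k - real n)\<^sup>2 / (2 * (real n + 1)))
    \<le> mode_prob n * exp (1 / (2 * (real n + 1)))"
  using assms
proof (induction k rule: dec_induct)
  case base
  have "(2 * real (n div 2) - real n)\<^sup>2 \<le> 1"
    by (cases "even n") (auto elim!: evenE oddE)
  then show ?case
    by (intro mult_mono) (auto simp: mode_prob_def divide_right_mono)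
next
  case (step k)
  define y where "y = (2 * real k + 1 - real n) / (real n + 1)"
  let ?w = "\<lambda>k. exp ((2 * real k - real n)\<^sup>2 / (2 * (real n + 1)))"
  have y: "0 \<le> y"
    using step.hyps unfolding y_def by (intro divide_nonneg_pos) auto
  have "(1 + y) * (fair_binom n (Suc k) * ?w (Suc k)) =
      fair_binom n k * ?w k * ((1 - y) * exp (2 * y))"
    using fair_binom_step_normalised[of k n] gaussian_weight_step[of 1 k n]
    by (simp add: y_def)
  also have "\<dots> \<le> fair_binom n k * ?w k * (1 + y)"
    by (intro mult_left_mono exp_double_mult_one_minus_le y) auto
  finally have "fair_binom n (Suc k) * ?w (Suc k) \<le> fair_binom n k * ?w k"
    using y by (simp add: mult.commute)
  also have "\<dots> \<le> mode_prob n * exp (1 / (2 * (real n + 1)))"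
    using step by simp
  finally show ?case .
qed

text \<open>
  Passing from variance \<open>n + 1\<close> to \<open>n\<close> costs only a constant factor, since \<open>\<bar>m\<bar> \<le> n\<close> implies
  \<open>m\<^sup>2 / n - (m\<^sup>2 - 1) / (n + 1) \<le> 1\<close>. The left half follows by symmetry.
\<close>
lemma fair_binom_gaussian_upper:
  assumes "1 \<le> n"
  shows "fair_binom n k \<le> exp (1 / 2) / sqrt (real n) * exp (- (2 * real k - real n)\<^sup>2 / (2 * real n))"
proof -
  let ?bound = "\<lambda>k. exp (1 / 2) / sqrt (real n) * exp (- (2 * real k - real n)\<^sup>2 / (2 * real n))"
  have main: "fair_binom n k \<le> ?bound k" if k: "n div 2 \<le> k" "k \<le> n" for k
  proof -
    define m where "m = 2 * real k - real n"
    have "fair_binom n k = fair_binom n k * exp (m\<^sup>2 / (2 * (real n + 1))) * exp (- m\<^sup>2 / (2 * (real n + 1)))"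
      by (simp add: mult.assoc flip: exp_add)
    also have "\<dots> \<le> mode_prob n * exp (1 / (2 * (real n + 1))) * exp (- m\<^sup>2 / (2 * (real n + 1)))"
      using fair_binom_upper_half[OF k] by (intro mult_right_mono) (auto simp: m_def)
    also have "\<dots> = mode_prob n * exp (1 / (2 * (real n + 1)) - m\<^sup>2 / (2 * (real n + 1)))"
      by (simp add: exp_add[symmetric] mult.assoc)
    also have "\<dots> \<le> 1 / sqrt (real n) * exp (1 / 2 - m\<^sup>2 / (2 * real n))"
    proof (intro mult_mono)
      have "\<bar>m\<bar> \<le> real n"
        using k by (auto simp: m_def)
      then have "m\<^sup>2 \<le> (real n)\<^sup>2"
        by (metis abs_ge_zero power2_abs power_mono)
      then have "real n + m\<^sup>2 \<le> real n * (real n + 1)"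
        by (simp add: power2_eq_square algebra_simps)
      then show "exp (1 / (2 * (real n + 1)) - m\<^sup>2 / (2 * (real n + 1))) \<le> exp (1 / 2 - m\<^sup>2 / (2 * real n))"
        using assms by (simp add: field_simps)
    qed (use mode_prob_upper[OF assms] in auto)
    also have "exp (1 / 2 - m\<^sup>2 / (2 * real n)) = exp (1 / 2) * exp (- m\<^sup>2 / (2 * real n))"
      by (simp flip: exp_add)
    finally show ?thesis
      by (simp add: m_def)
  qed
  consider "n < k" | "n div 2 \<le> k" "k \<le> n" | "k < n div 2"
    by linarith
  then show ?thesis
  proof cases
    case 1
    then show ?thesis by (simp add: fair_binom_eq_0)
  next
    case 2
    then show ?thesis by (rule main)
  next
    case 3
    then have "k \<le> n"
      by simp
    then have "fair_binom n (n - k) = fair_binom n k" "2 * real (n - k) - real n = - (2 * real k - real n)"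
      by (simp_all add: fair_binom_symmetric[of k n] of_nat_diff)
    moreover have "fair_binom n (n - k) \<le> ?bound (n - k)"
      by (rule main) (use 3 in linarith)+
    ultimately show ?thesis
      by (simp only: power2_minus)
  qed
qed

text \<open>
  The weights now grow slightly faster, with the factor \<open>1 + \<delta>\<close> in the exponent, and the weighted
  masses increase to the right of the mode as long as the step parameter \<open>y\<close> is at most
  \<open>\<delta> / 2\<close>. The hypothesis on \<open>K\<close> ensures this for every step before \<open>K\<close>.
\<close>
lemma fair_binom_lower_half:
  assumes "n div 2 \<le> k" "k \<le> K" and \<delta>: "0 \<le> \<delta>" "\<delta> \<le> 1" "2 * (2 * real K - real n) \<le> \<delta> * real n"
  shows "mode_prob n \<le> fair_binom n k * exp ((1 + \<delta>) * (2 * real k - real n)\<^sup>2 / (2 * (real n + 1)))"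
  using assms(1,2)
proof (induction k rule: dec_induct)
  case base
  have "mode_prob n * 1 \<le> fair_binom n (n div 2) *
      exp ((1 + \<delta>) * (2 * real (n div 2) - real n)\<^sup>2 / (2 * (real n + 1)))"
    using \<delta> by (intro mult_mono) (auto simp: mode_prob_def)
  then show ?case by simp
next
  case (step k)
  define y where "y = (2 * real k + 1 - real n) / (real n + 1)"
  let ?w = "\<lambda>k. exp ((1 + \<delta>) * (2 * real k - real n)\<^sup>2 / (2 * (real n + 1)))"
  have y0: "0 \<le> y"
    using step.hyps unfolding y_def by (intro divide_nonneg_pos) auto
  have "y * (real n + 1) = 2 * real k + 1 - real n"
    by (simp add: y_def)
  then have "2 * y * (real n + 1) \<le> \<delta> * (real n + 1)"
    using step.prems \<delta> by (simp add: algebra_simps)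
  then have y1: "2 * y \<le> \<delta>"
    by (simp add: mult_le_cancel_right_pos)
  have "(1 + y) * mode_prob n \<le> (1 + y) * (fair_binom n k * ?w k)"
    using step y0 by (intro mult_left_mono) auto
  also have "\<dots> \<le> fair_binom n k * ?w k * ((1 - y) * exp (2 * y * (1 + \<delta>)))"
  proof -
    have "1 + y \<le> (1 - y) * exp (2 * y * (1 + 2 * y))"
      using y0 y1 \<delta> by (intro one_plus_le_exp_mult_one_minus) auto
    also have "\<dots> \<le> (1 - y) * exp (2 * y * (1 + \<delta>))"
      using y0 y1 \<delta> by (intro mult_left_mono) (auto intro!: mult_left_mono)
    finally have "fair_binom n k * ?w k * (1 + y) \<le> fair_binom n k * ?w k * ((1 - y) * exp (2 * y * (1 + \<delta>)))"
      by (intro mult_left_mono) auto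
    then show ?thesis by (simp only: mult_ac)
  qed
  also have "\<dots> = (1 + y) * (fair_binom n (Suc k) * ?w (Suc k))"
    using fair_binom_step_normalised[of k n] gaussian_weight_step[of "1 + \<delta>" k n]
    by (simp add: y_def)
  finally show ?case
    using y0 by (subst (asm) mult_le_cancel_left_pos) auto
qed

text \<open>
  The cube of \<open>x / 3 \<le> exp (x / 3)\<close>.
\<close>
lemma cube_mult_exp_minus_le:
  fixes x :: real
  assumes "0 \<le> x"
  shows "x ^ 3 * exp (- x) \<le> 27"
proof -
  have "(x / 3) ^ 3 \<le> exp (x / 3) ^ 3"
    using assms exp_ge_add_one_self[of "x / 3"] by (intro power_mono) linarith+
  also have "\<dots> = exp x"
    by (simp flip: exp_of_nat_mult)
  finally have "x ^ 3 \<le> 27 * exp x"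
    by (simp add: power_divide)
  then have "x ^ 3 * exp (- x) \<le> 27 * exp x * exp (- x)"
    by (rule mult_right_mono) simp
  then show ?thesis
    by (simp add: mult.assoc flip: exp_add)
qed

text \<open>
  With \<open>m = 2 k - n \<ge> 0\<close> and \<open>\<delta> = 2 m / n\<close>, the loss in the exponent of the preceding comparison is
  \<open>m\<^sup>3 / n\<^sup>2\<close>. If this is at most \<open>1 / 8\<close>, the mass is at least a constant multiple of the
  Gaussian. If it is larger, then \<open>m\<^sup>2 / (2 n)\<close> is at least of order \<open>n\<close> to the power \<open>1 / 3\<close>, so the Gaussian factor is \<open>O(1 / n)\<close> and the
  subtracted error term makes the left-hand side nonpositive.
\<close>
lemma fair_binom_gaussian_lower:
  assumes n: "2 \<le> n"
  shows "1 / (4 * sqrt (real n)) * exp (- (2 * real k - real n)\<^sup>2 / (2 * real n)) - 3456 / (real n * sqrt (real n))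
    \<le> fair_binom n k"
proof -
  let ?bound = "\<lambda>k. 1 / (4 * sqrt (real n)) * exp (- (2 * real k - real n)\<^sup>2 / (2 * real n))
    - 3456 / (real n * sqrt (real n))"
  have main: "?bound k \<le> fair_binom n k" if k: "n \<le> 2 * k" for k
  proof -
    define m where "m = 2 * real k - real n"
    have m0: "0 \<le> m"
      using k by (simp add: m_def)
    have n0: "0 < real n" "1 \<le> real n"
      using n by auto
    show ?thesis
    proof (cases "8 * m ^ 3 \<le> (real n)\<^sup>2")
      case True
      define \<delta> where "\<delta> = 2 * m / real n"
      have \<delta>0: "0 \<le> \<delta>"
        using m0 by (simp add: \<delta>_def)
      have "2 * m \<le> real n"
      proof (rule ccontr)
        assume "\<not> 2 * m \<le> real n"
        then have "real n ^ 3 < (2 * m) ^ 3"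
          by (intro power_strict_mono) auto
        moreover have "(real n)\<^sup>2 \<le> real n ^ 3"
          using n0 by (intro power_increasing) auto
        ultimately show False
          using True by (simp add: power_mult_distrib)
      qed
      then have \<delta>1: "\<delta> \<le> 1"
        using n0 by (simp add: \<delta>_def)
      have "mode_prob n \<le> fair_binom n k * exp ((1 + \<delta>) * m\<^sup>2 / (2 * (real n + 1)))"
        unfolding m_def
        by (rule fair_binom_lower_half[where K = k]) (use k \<delta>0 \<delta>1 n0 in \<open>auto simp: \<delta>_def m_def\<close>)
      also have "\<dots> \<le> fair_binom n k * exp (m\<^sup>2 / (2 * real n) + 1 / 8)"
      proof (intro mult_left_mono)
        have "(1 + \<delta>) * m\<^sup>2 / (2 * (real n + 1)) \<le> (1 + \<delta>) * m\<^sup>2 / (2 * real n)"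
          using \<delta>0 n0 by (intro divide_left_mono) auto
        also have "\<dots> = m\<^sup>2 / (2 * real n) + m ^ 3 / (real n)\<^sup>2"
          using n0 by (simp add: \<delta>_def field_simps power2_eq_square power3_eq_cube)
        also have "m ^ 3 / (real n)\<^sup>2 \<le> 1 / 8"
          using True n0 by (simp add: field_simps)
        finally show "exp ((1 + \<delta>) * m\<^sup>2 / (2 * (real n + 1))) \<le> exp (m\<^sup>2 / (2 * real n) + 1 / 8)"
          by simp
      qed auto
      finally have "mode_prob n * exp (- (m\<^sup>2 / (2 * real n) + 1 / 8))
          \<le> fair_binom n k * exp (m\<^sup>2 / (2 * real n) + 1 / 8) * exp (- (m\<^sup>2 / (2 * real n) + 1 / 8))"
        by (rule mult_right_mono) simp
      also have "\<dots> = fair_binom n k"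
        by (simp add: mult.assoc flip: exp_add)
      finally have upper: "mode_prob n * (exp (- 1 / 8) * exp (- m\<^sup>2 / (2 * real n))) \<le> fair_binom n k"
        by (simp add: algebra_simps flip: exp_add)
      have "1 / (4 * sqrt (real n)) \<le> 1 / sqrt (3 * real n) * (7 / 8)"
      proof -
        have "sqrt 3 \<le> 2"
          by (rule real_le_lsqrt) auto
        then show ?thesis
          using n0 by (simp add: real_sqrt_mult field_simps)
      qed
      also have "\<dots> \<le> mode_prob n * exp (- 1 / 8)"
        using mode_prob_lower[OF n] exp_ge_add_one_self[of "- 1 / 8"] by (intro mult_mono) (auto simp: mode_prob_def)
      finally have "1 / (4 * sqrt (real n)) * exp (- m\<^sup>2 / (2 * real n))
          \<le> mode_prob n * exp (- 1 / 8) * exp (- m\<^sup>2 / (2 * real n))"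
        by (rule mult_right_mono) simp
      moreover have "0 \<le> 3456 / (real n * sqrt (real n))"
        by simp
      ultimately show ?thesis
        using upper unfolding m_def[symmetric] by (simp only: mult.assoc)
    next
      case False
      define x where "x = m\<^sup>2 / (2 * real n)"
      \<comment> \<open>Squaring \<open>n\<^sup>2 \<le> 8 m\<^sup>3\<close> gives \<open>n \<le> 512 x\<^sup>3\<close>, and \<open>3456\<close> is a quarter of \<open>512 * 27\<close>.\<close>
      have "(real n)\<^sup>2 * (real n)\<^sup>2 \<le> (8 * m ^ 3) * (8 * m ^ 3)"
        using False m0 by (intro mult_mono) auto
      also have "\<dots> = 512 * (real n ^ 3 * x ^ 3)"
        using n0 by (simp add: x_def power_divide power_mult_distrib flip: power_mult power_add)
      finally have "real n \<le> 512 * x ^ 3"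
        using n0 by (simp add: power2_eq_square power3_eq_cube)
      then have "real n * exp (- x) \<le> 512 * x ^ 3 * exp (- x)"
        by (rule mult_right_mono) simp
      also have "\<dots> \<le> 512 * 27"
        using cube_mult_exp_minus_le[of x] by (simp add: x_def mult.commute)
      finally have "exp (- x) \<le> 13824 / real n"
        using n0 by (simp add: field_simps)
      then have "1 / (4 * sqrt (real n)) * exp (- x) \<le> 1 / (4 * sqrt (real n)) * (13824 / real n)"
        by (rule mult_left_mono) simp
      then have "1 / (4 * sqrt (real n)) * exp (- x) - 3456 / (real n * sqrt (real n)) \<le> 0"
        by (simp add: mult.commute)
      also have "0 \<le> fair_binom n k"
        by simp
      finally show ?thesis
        by (simp add: x_def m_def)
    qed
  qed
  show ?thesis
  proof (cases "n \<le> 2 * k")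
    case True
    then show ?thesis by (rule main)
  next
    case False
    then have "k \<le> n"
      by simp
    then have "fair_binom n (n - k) = fair_binom n k" "2 * real (n - k) - real n = - (2 * real k - real n)"
      by (simp_all add: fair_binom_symmetric[of k n] of_nat_diff)
    moreover have "?bound (n - k) \<le> fair_binom n (n - k)"
      by (rule main) (use False in linarith)
    ultimately show ?thesis
      by (simp only: power2_minus)
  qed
qed

section \<open>Multiples of a small modulus\<close>

text \<open>
  Cut the line into blocks of length \<open>d\<close> that start at multiples of \<open>d\<close>. In a block left of the mode
  \<open>h\<close> every value is at most the value at the next multiple, in a block right of it at most the value
  at its first point, and in the block that contains \<open>h\<close> at most \<open>f h\<close>. No multiple is used twice.
\<close>
lemma sum_unimodal_le:
  fixes f :: "nat \<Rightarrow> real" and d h N :: nat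
  assumes nonneg: "\<And>k. 0 \<le> f k"
    and incr: "\<And>i j. i \<le> j \<Longrightarrow> j \<le> h \<Longrightarrow> f i \<le> f j"
    and decr: "\<And>i j. h \<le> i \<Longrightarrow> i \<le> j \<Longrightarrow> f j \<le> f i"
    and d: "1 \<le> d" and N: "h \<le> N"
  shows "(\<Sum>k<Suc N * d. f k) \<le> real d * ((\<Sum>j\<le>N. f (d * j)) + f h)"
proof -
  define q where "q = h div d"
  have q: "d * q \<le> h" "h < d * Suc q"
    using d by (auto simp: q_def dividend_less_times_div)
  have "q \<le> N"
    using N unfolding q_def by (meson div_le_dividend le_trans)
  have max: "f k \<le> f h" for k
    using incr[of k h] decr[of h k] by (cases "k \<le> h") auto
  \<comment> \<open>The bound used for all values in block \<open>m\<close>; block \<open>q\<close> contains the mode.\<close>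
  define g where "g m = (if m < q then f (d * Suc m) else if m = q then f h else f (d * m))" for m
  have "(\<Sum>k<Suc N * d. f k) = (\<Sum>m<Suc N. \<Sum>k\<in>{m * d..<m * d + d}. f k)"
    by (rule sum.nat_group[symmetric])
  also have "\<dots> \<le> (\<Sum>m<Suc N. \<Sum>k\<in>{m * d..<m * d + d}. g m)"
  proof (intro sum_mono)
    fix m k
    assume "k \<in> {m * d..<m * d + d}"
    then have k: "d * m \<le> k" "k \<le> d * Suc m"
      by (auto simp: mult.commute)
    consider "m < q" | "m = q" | "q < m"
      by linarith
    then show "f k \<le> g m"
    proof cases
      case 1
      then have "d * Suc m \<le> d * q"
        by (intro mult_left_mono) auto
      with 1 k q show ?thesis
        by (auto simp: g_def intro!: incr)
    next
      case 2
      then show ?thesis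
        by (simp add: g_def max)
    next
      case 3
      then have "d * Suc q \<le> d * m"
        by (intro mult_left_mono) auto
      with 3 k q show ?thesis
        by (auto simp: g_def intro!: decr)
    qed
  qed
  also have "\<dots> = real d * (\<Sum>m\<le>N. g m)"
    by (simp add: sum_distrib_left lessThan_Suc_atMost)
  also have "(\<Sum>m\<le>N. g m) \<le> (\<Sum>j\<le>N. f (d * j)) + f h"
  proof -
    have "(\<Sum>m\<le>N. g m) = (\<Sum>m\<in>{..<q} \<union> insert q {q<..N}. g m)"
      using \<open>q \<le> N\<close> by (intro sum.cong) auto
    also have "\<dots> = (\<Sum>m<q. g m) + (g q + (\<Sum>m\<in>{q<..N}. g m))"
      by (subst sum.union_disjoint) auto
    also have "(\<Sum>m<q. g m) = (\<Sum>m<q. f (d * Suc m))"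
      by (simp add: g_def)
    also have "\<dots> = (\<Sum>j\<in>Suc ` {..<q}. f (d * j))"
      by (subst sum.reindex) auto
    also have "g q = f h"
      by (simp add: g_def)
    also have "(\<Sum>m\<in>{q<..N}. g m) = (\<Sum>j\<in>{q<..N}. f (d * j))"
      by (simp add: g_def)
    also have "(\<Sum>j\<in>Suc ` {..<q}. f (d * j)) + (f h + (\<Sum>j\<in>{q<..N}. f (d * j))) =
        (\<Sum>j\<in>Suc ` {..<q} \<union> {q<..N}. f (d * j)) + f h"
      by (subst sum.union_disjoint) auto
    also have "(\<Sum>j\<in>Suc ` {..<q} \<union> {q<..N}. f (d * j)) \<le> (\<Sum>j\<le>N. f (d * j))"
      using \<open>q \<le> N\<close> nonneg by (intro sum_mono2) auto
    finally show ?thesis by simp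
  qed
  finally show ?thesis
    by (simp add: mult_left_mono)
qed

text \<open>
  For \<open>d\<close> below \<open>sqrt n / 2\<close> the central mass is at most half of \<open>1 / d\<close>, so this gives the right order
  of magnitude without any Gaussian approximation.
\<close>
lemma fair_binom_dvd_ge:
  assumes "1 \<le> d"
  shows "1 / real d - mode_prob n \<le> fair_binom_dvd n d"
proof -
  have "1 = (\<Sum>k\<le>n. fair_binom n k)"
    by (simp add: sum_fair_binom)
  also have "\<dots> \<le> (\<Sum>k<Suc n * d. fair_binom n k)"
  proof (intro sum_mono2)
    have "Suc n * 1 \<le> Suc n * d"
      using assms by (intro mult_left_mono) auto
    then have "n < Suc n * d"
      by (simp only: mult_1_right less_eq_Suc_le)
    then show "{..n} \<subseteq> {..<Suc n * d}"
      by (auto simp del: mult_Suc)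
  qed auto
  also have "\<dots> \<le> real d * (fair_binom_dvd n d + mode_prob n)"
    unfolding fair_binom_dvd_def mode_prob_def
  proof (rule sum_unimodal_le)
    show "fair_binom n i \<le> fair_binom n j" if "i \<le> j" "j \<le> n div 2" for i j
      using binomial_mono[of i j n] that by (simp add: fair_binom_def divide_right_mono)
    show "fair_binom n j \<le> fair_binom n i" if "n div 2 \<le> i" "i \<le> j" for i j
      using binomial_antimono[of i j n] that
      by (cases "j \<le> n") (auto simp: fair_binom_def divide_right_mono binomial_eq_0)
  qed (use assms in auto)
  finally show ?thesis
    using assms by (simp add: field_simps)
qed

section \<open>The upper bound by the envelope\<close>

text \<open>
  The inequality \<open>(c i)\<^sup>2 \<ge> c i - 1 / 4\<close> dominates the Gaussian sum by a geometric series.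
\<close>
lemma sum_gaussian_le:
  fixes c :: real
  assumes "0 < c"
  shows "(\<Sum>i<N. exp (- (c * real i)\<^sup>2)) \<le> exp (1 / 4) * (1 + 1 / c)"
proof -
  have "(\<Sum>i<N. exp (- (c * real i)\<^sup>2)) \<le> (\<Sum>i<N. exp (1 / 4) * exp (- c) ^ i)"
  proof (intro sum_mono)
    fix i
    have "0 \<le> (c * real i - 1 / 2)\<^sup>2"
      by simp
    then have "- (c * real i)\<^sup>2 \<le> 1 / 4 - c * real i"
      by (simp add: power2_eq_square algebra_simps)
    then have "exp (- (c * real i)\<^sup>2) \<le> exp (1 / 4 - c * real i)"
      by simp
    also have "\<dots> = exp (1 / 4) * exp (- c) ^ i"
      by (simp add: algebra_simps flip: exp_of_nat_mult exp_add)
    finally show "exp (- (c * real i)\<^sup>2) \<le> exp (1 / 4) * exp (- c) ^ i" .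
  qed
  also have "\<dots> = exp (1 / 4) * (\<Sum>i<N. exp (- c) ^ i)"
    by (simp add: sum_distrib_left)
  also have "\<dots> \<le> exp (1 / 4) * (1 + 1 / c)"
  proof (intro mult_left_mono)
    have "(\<Sum>i<N. exp (- c) ^ i) \<le> (\<Sum>i. exp (- c) ^ i)"
      using assms by (intro sum_le_suminf summable_geometric) auto
    also have "\<dots> = 1 / (1 - exp (- c))"
      using assms by (intro suminf_geometric) auto
    also have "\<dots> \<le> 1 + 1 / c"
    proof -
      have "exp (- c) \<le> 1 / (1 + c)"
        using exp_ge_add_one_self[of c] assms by (simp add: exp_minus field_simps)
      then have "c / (1 + c) \<le> 1 - exp (- c)"
        using assms by (simp add: field_simps)
      then have "1 / (1 - exp (- c)) \<le> 1 / (c / (1 + c))"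
        using assms by (intro divide_left_mono) auto
      then show ?thesis
        using assms by (simp add: field_simps)
    qed
    finally show "(\<Sum>i<N. exp (- c) ^ i) \<le> 1 + 1 / c" .
  qed simp
  finally show ?thesis .
qed

text \<open>
  Dropping the nonnegative cross term in the square splits off the leading Gaussian and leaves the
  preceding sum with \<open>c = sqrt 2 d / sqrt n\<close>.
\<close>
lemma sum_gaussian_progression_le:
  fixes n d N :: nat and r :: real
  assumes "0 \<le> r" "1 \<le> d" "1 \<le> n"
  shows "(\<Sum>i<N. exp (- (r + 2 * real d * real i)\<^sup>2 / (2 * real n)))
    \<le> exp (1 / 4) * (1 + sqrt (real n) / (sqrt 2 * real d)) * exp (- r\<^sup>2 / (2 * real n))"
proof -
  define c where "c = sqrt 2 * real d / sqrt (real n)"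
  have c: "0 < c" and c2: "c\<^sup>2 = 2 * (real d)\<^sup>2 / real n"
    using assms by (auto simp: c_def power_divide power_mult_distrib)
  have "(\<Sum>i<N. exp (- (r + 2 * real d * real i)\<^sup>2 / (2 * real n)))
      \<le> (\<Sum>i<N. exp (- (c * real i)\<^sup>2) * exp (- r\<^sup>2 / (2 * real n)))"
  proof (intro sum_mono)
    fix i
    have "r\<^sup>2 + (2 * real d * real i)\<^sup>2 \<le> (r + 2 * real d * real i)\<^sup>2"
      using assms by (simp add: power2_sum)
    then have "(r\<^sup>2 + (2 * real d * real i)\<^sup>2) / (2 * real n) \<le> (r + 2 * real d * real i)\<^sup>2 / (2 * real n)"
      by (rule divide_right_mono) simp
    then have "- (r + 2 * real d * real i)\<^sup>2 / (2 * real n) \<le> - (c * real i)\<^sup>2 + - r\<^sup>2 / (2 * real n)"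
      using assms by (simp add: power_mult_distrib c2 add_divide_distrib)
    then show "exp (- (r + 2 * real d * real i)\<^sup>2 / (2 * real n)) \<le> exp (- (c * real i)\<^sup>2) * exp (- r\<^sup>2 / (2 * real n))"
      by (simp flip: exp_add)
  qed
  also have "\<dots> = (\<Sum>i<N. exp (- (c * real i)\<^sup>2)) * exp (- r\<^sup>2 / (2 * real n))"
    by (simp add: sum_distrib_right)
  also have "\<dots> \<le> exp (1 / 4) * (1 + 1 / c) * exp (- r\<^sup>2 / (2 * real n))"
    by (intro mult_right_mono sum_gaussian_le c) simp
  finally show ?thesis
    by (simp add: c_def)
qed

definition envelope :: "nat \<Rightarrow> nat \<Rightarrow> real" where
  "envelope n d = max (1 / (2 * real d)) (1 / sqrt (real n)) *
     (exp (- (real (res d n))\<^sup>2 / (2 * real n)) + exp (- (real (co_res d n))\<^sup>2 / (2 * real n)))"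

lemma envelope_pos: "1 \<le> d \<Longrightarrow> 0 < envelope n d"
  unfolding envelope_def by (intro mult_pos_pos add_pos_pos) (auto simp: less_max_iff_disj)

lemma real_eq_quotient_res: "real n = 2 * real d * real (n div (2 * d)) + real (res d n)"
proof -
  have "n = 2 * d * (n div (2 * d)) + res d n"
    by (simp add: res_def)
  then have "real n = real (2 * d * (n div (2 * d)) + res d n)"
    by simp
  then show ?thesis
    by simp
qed

lemma real_co_res: "1 \<le> d \<Longrightarrow> real (co_res d n) = 2 * real d - real (res d n)"
  by (simp add: co_res_def res_def of_nat_diff mod_less_divisor less_imp_le)

text \<open>
  Write \<open>n = 2 d q + r\<close> with \<open>r = res d n\<close>. For \<open>j \<le> q\<close> the deviation \<open>\<bar>2 d j - n\<bar>\<close> is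
  \<open>r + 2 d (q - j)\<close>, and for \<open>j > q\<close> it is \<open>co_res d n + 2 d (j - q - 1)\<close>. So the Gaussian bound for
  the masses is summed along two arithmetic progressions, which start at the two residues.
\<close>
lemma fair_binom_dvd_le_envelope:
  assumes n: "1 \<le> n" and d: "1 \<le> d"
  shows "fair_binom_dvd n d \<le> 8 * envelope n d"
proof -
  define q where "q = n div (2 * d)"
  define g where "g t = exp (- t\<^sup>2 / (2 * real n))" for t :: real
  define A where "A = exp (1 / 4) * (1 + sqrt (real n) / (sqrt 2 * real d))"
  let ?r = "real (res d n)" and ?s = "real (co_res d n)"
  note n_eq = real_eq_quotient_res[of n d, folded q_def]
  note s_eq = real_co_res[OF d, of n]
  have "q \<le> n"
    by (simp add: q_def)
  have "fair_binom_dvd n d \<le> (\<Sum>j\<le>n. exp (1 / 2) / sqrt (real n) * g (2 * real (d * j) - real n))"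
    unfolding fair_binom_dvd_def g_def by (intro sum_mono fair_binom_gaussian_upper n)
  also have "\<dots> = exp (1 / 2) / sqrt (real n) * (\<Sum>j\<le>n. g (2 * real (d * j) - real n))"
    by (simp add: sum_distrib_left)
  also have "(\<Sum>j\<le>n. g (2 * real (d * j) - real n)) =
      (\<Sum>j<Suc q. g (2 * real (d * j) - real n)) + (\<Sum>j\<in>{Suc q..<Suc n}. g (2 * real (d * j) - real n))"
    using \<open>q \<le> n\<close> by (subst sum.union_disjoint[symmetric]) (auto intro!: sum.cong)
  also have "(\<Sum>j<Suc q. g (2 * real (d * j) - real n)) = (\<Sum>i<Suc q. g (?r + 2 * real d * real i))"
  proof -
    have "(\<Sum>j<Suc q. g (2 * real (d * j) - real n)) = (\<Sum>i<Suc q. g (2 * real (d * (Suc q - Suc i)) - real n))"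
      by (rule sum.nat_diff_reindex[symmetric])
    also have "\<dots> = (\<Sum>i<Suc q. g (?r + 2 * real d * real i))"
    proof (rule sum.cong)
      fix i assume "i \<in> {..<Suc q}"
      then have "2 * real (d * (Suc q - Suc i)) - real n = - (?r + 2 * real d * real i)"
        using n_eq by (simp add: of_nat_diff algebra_simps)
      then show "g (2 * real (d * (Suc q - Suc i)) - real n) = g (?r + 2 * real d * real i)"
        by (simp only: g_def power2_minus)
    qed simp
    finally show ?thesis .
  qed
  also have "(\<Sum>j\<in>{Suc q..<Suc n}. g (2 * real (d * j) - real n)) = (\<Sum>i<n - q. g (?s + 2 * real d * real i))"
  proof -
    have "(\<Sum>j\<in>{Suc q..<Suc n}. g (2 * real (d * j) - real n)) =
        (\<Sum>i<n - q. g (2 * real (d * (i + Suc q)) - real n))"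
      using sum.shift_bounds_nat_ivl[of "\<lambda>j. g (2 * real (d * j) - real n)" 0 "Suc q" "n - q"] \<open>q \<le> n\<close>
      by (simp add: lessThan_atLeast0)
    also have "\<dots> = (\<Sum>i<n - q. g (?s + 2 * real d * real i))"
      using n_eq s_eq by (intro sum.cong arg_cong[where f = g]) (auto simp: algebra_simps)
    finally show ?thesis .
  qed
  also have "exp (1 / 2) / sqrt (real n) *
      ((\<Sum>i<Suc q. g (?r + 2 * real d * real i)) + (\<Sum>i<n - q. g (?s + 2 * real d * real i)))
      \<le> exp (1 / 2) / sqrt (real n) * (A * g ?r + A * g ?s)"
    unfolding g_def A_def using n d
    by (intro mult_left_mono add_mono sum_gaussian_progression_le) auto
  also have "\<dots> = exp (1 / 2) / sqrt (real n) * A * (g ?r + g ?s)"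
    by (simp only: distrib_left mult.assoc)
  also have "\<dots> \<le> 8 * max (1 / (2 * real d)) (1 / sqrt (real n)) * (g ?r + g ?s)"
  proof (intro mult_right_mono)
    let ?X = "max (1 / (2 * real d)) (1 / sqrt (real n))"
    have "exp (1 / 2) / sqrt (real n) * A = exp (3 / 4) * (1 / sqrt (real n) + sqrt 2 * (1 / (2 * real d)))"
    proof -
      have "exp (3 / 4 :: real) = exp (1 / 2) * exp (1 / 4)"
        by (simp flip: exp_add)
      moreover have "1 / sqrt 2 = sqrt 2 / 2"
        by (simp add: real_div_sqrt field_simps)
      ultimately show ?thesis
        using n d by (simp add: A_def field_simps)
    qed
    also have "\<dots> \<le> 3 * (?X + 3 / 2 * ?X)"
    proof (intro mult_mono add_mono)
      have "exp (3 / 4) \<le> exp (1 :: real)"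
        by simp
      with exp_le show "exp (3 / 4) \<le> (3 :: real)"
        by linarith
      show "sqrt 2 \<le> 3 / 2"
        by (rule real_le_lsqrt) (auto simp: power2_eq_square)
    qed auto
    also have "\<dots> \<le> 8 * ?X"
      by (simp add: le_max_iff_disj)
    finally show "exp (1 / 2) / sqrt (real n) * A \<le> 8 * ?X" .
  qed (auto simp: g_def add_nonneg_nonneg)
  finally show ?thesis
    by (simp add: envelope_def g_def mult.assoc)
qed

section \<open>The lower bound up to a small error\<close>

text \<open>
  For small \<open>d\<close> the envelope is at most \<open>1 / d\<close> and unimodality suffices. For large \<open>d\<close> the two
  multiples \<open>k\<close> of \<open>d\<close> next to \<open>n / 2\<close> have \<open>2 k - n\<close> equal to \<open>- res d n\<close> and \<open>co_res d n\<close>, and their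
  masses alone reproduce both Gaussians of the envelope. The second multiple may exceed \<open>n\<close>; its mass is then zero
  and the pointwise bound still holds.
\<close>
lemma fair_binom_dvd_ge_envelope:
  assumes n: "2 \<le> n" and d: "1 \<le> d"
  shows "1 / 4 * envelope n d - 6912 / (real n * sqrt (real n)) \<le> fair_binom_dvd n d"
proof (cases "2 * real d \<le> sqrt (real n)")
  case True
  define v where "v = 1 / real d"
  have "envelope n d \<le> 1 / (2 * real d) * (1 + 1)"
    unfolding envelope_def
  proof (intro mult_mono add_mono)
    show "max (1 / (2 * real d)) (1 / sqrt (real n)) \<le> 1 / (2 * real d)"
      using True d n by (auto intro!: divide_left_mono mult_pos_pos)
  qed (auto simp: add_nonneg_nonneg)
  then have "envelope n d \<le> v"
    by (simp add: v_def)
  moreover have "mode_prob n \<le> v / 2"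
  proof -
    have "1 / sqrt (real n) \<le> 1 / (2 * real d)"
      using True d n by (intro divide_left_mono mult_pos_pos) auto
    with mode_prob_upper[of n] n show ?thesis by (simp add: v_def)
  qed
  moreover have "0 \<le> v"
    by (simp add: v_def)
  moreover have "v - mode_prob n \<le> fair_binom_dvd n d"
    using fair_binom_dvd_ge[OF d, of n] by (simp add: v_def)
  ultimately have "1 / 4 * envelope n d \<le> fair_binom_dvd n d"
    by linarith
  then show ?thesis
    by (rule order_trans[rotated]) simp
next
  case False
  define q where "q = n div (2 * d)"
  define e where "e = 3456 / (real n * sqrt (real n))"
  note n_eq = real_eq_quotient_res[of n d, folded q_def]
  have "q < n"
    using n d by (simp add: q_def)
  have "2 * real (d * q) - real n = - real (res d n)"
    "2 * real (d * Suc q) - real n = real (co_res d n)"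
    using n_eq real_co_res[OF d, of n] by (auto simp: algebra_simps)
  then have "1 / (4 * sqrt (real n)) * exp (- (real (res d n))\<^sup>2 / (2 * real n)) - e \<le> fair_binom n (d * q)"
    "1 / (4 * sqrt (real n)) * exp (- (real (co_res d n))\<^sup>2 / (2 * real n)) - e \<le> fair_binom n (d * Suc q)"
    using fair_binom_gaussian_lower[OF n, of "d * q"] fair_binom_gaussian_lower[OF n, of "d * Suc q"]
    by (simp_all only: power2_minus e_def)
  moreover have "fair_binom n (d * q) + fair_binom n (d * Suc q) \<le> fair_binom_dvd n d"
  proof -
    have "fair_binom n (d * q) + fair_binom n (d * Suc q) = (\<Sum>j\<in>{q, Suc q}. fair_binom n (d * j))"
      by simp
    also have "\<dots> \<le> fair_binom_dvd n d"
      unfolding fair_binom_dvd_def using \<open>q < n\<close> by (intro sum_mono2) auto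
    finally show ?thesis .
  qed
  moreover have "max (1 / (2 * real d)) (1 / sqrt (real n)) = 1 / sqrt (real n)"
    using False d n by (intro max_absorb2 divide_left_mono mult_pos_pos) auto
  then have "1 / 4 * envelope n d = 1 / (4 * sqrt (real n)) * exp (- (real (res d n))\<^sup>2 / (2 * real n))
      + 1 / (4 * sqrt (real n)) * exp (- (real (co_res d n))\<^sup>2 / (2 * real n))"
    by (simp add: envelope_def distrib_left)
  moreover have "6912 / (real n * sqrt (real n)) = 2 * e"
    by (simp add: e_def)
  ultimately show ?thesis
    by linarith
qed

section \<open>The approximating function\<close>

lemma inverse_three_halves_le_log:
  assumes "2 \<le> n"
  shows "1 / (real n * sqrt (real n)) \<le> 8 * (ln (real n) powr (5 / 2) / real n powr (3 / 2))"
proof -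
  have ln2: "1 / 2 \<le> ln (2 :: real)"
    using ln2_ge_two_thirds by linarith
  also have "ln 2 \<le> ln (real n)"
    using assms by simp
  finally have "(1 / 2) powr (5 / 2) \<le> ln (real n) powr (5 / 2)"
    by (intro powr_mono2) auto
  moreover have "(1 / 8 :: real) = (1 / 2) powr 3"
    by (simp add: powr_numeral power3_eq_cube)
  moreover have "\<dots> \<le> (1 / 2) powr (5 / 2)"
    by (intro powr_mono') auto
  ultimately have "1 \<le> 8 * ln (real n) powr (5 / 2)"
    by linarith
  moreover have "real n powr (3 / 2) = real n * sqrt (real n)"
    using assms powr_add[of "real n" 1 "1 / 2"] by (simp add: powr_half_sqrt)
  ultimately show ?thesis
    using assms by (simp add: divide_right_mono)
qed

theorem theorem2:
  "\<exists>(E :: nat \<Rightarrow> nat \<Rightarrow> real) (C :: real). C > 0 \<and>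
     (\<forall>(M :: 'a measure) (\<epsilon> :: nat \<Rightarrow> 'a \<Rightarrow> int). iid_fair_bits M \<epsilon> \<longrightarrow>
        (\<forall>n\<ge>2. (SUP d\<in>{2..n}.
              \<bar>measure M {\<omega> \<in> space M. int d dvd partial_sum \<epsilon> n \<omega>} - E n d\<bar>)
            \<le> C * (ln (real n) powr (5 / 2) / real n powr (3 / 2)))) \<and>
     (\<forall>n d. 2 \<le> d \<and> d \<le> n \<longrightarrow>
        1 / (2 * sqrt (2 * pi))
          \<le> E n d / (max (1 / (2 * real d)) (1 / sqrt (real n)) *
              (exp (- (real (res d n))\<^sup>2 / (2 * real n)) +
               exp (- (real (co_res d n))\<^sup>2 / (2 * real n)))) \<and>
        E n d / (max (1 / (2 * real d)) (1 / sqrt (real n)) *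
              (exp (- (real (res d n))\<^sup>2 / (2 * real n)) +
               exp (- (real (co_res d n))\<^sup>2 / (2 * real n))))
          \<le> 32 / sqrt (2 * pi))"
proof -
  \<comment> \<open>The approximant is the exact probability, raised to the required lower bound where it
    falls below it.\<close>
  define l where "l = 1 / (2 * sqrt (2 * pi))"
  define E where "E = (\<lambda>n d. max (l * envelope n d) (fair_binom_dvd n d))"
  have pi: "2 \<le> sqrt (2 * pi)" "sqrt (2 * pi) \<le> 3"
  proof -
    show "2 \<le> sqrt (2 * pi)"
      using pi_ge_two by (intro real_le_rsqrt) auto
    show "sqrt (2 * pi) \<le> 3"
      using pi_less_4 by (intro real_le_lsqrt) auto
  qed
  have l: "l \<le> 1 / 4" "l \<le> 8"
    using pi by (simp_all add: l_def field_simps)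
  have u: "8 \<le> 32 / sqrt (2 * pi)"
    using pi by (simp add: field_simps)
  have error: "\<bar>fair_binom_dvd n d - E n d\<bar> \<le> 55296 * (ln (real n) powr (5 / 2) / real n powr (3 / 2))"
    if "2 \<le> n" "2 \<le> d" for n d
  proof -
    \<comment> \<open>Where the maximum is not the probability itself, the error is the shortfall, which the
      lower bound by the envelope controls.\<close>
    have "l * envelope n d \<le> 1 / 4 * envelope n d"
      using l envelope_pos[of d n] that by (intro mult_right_mono) auto
    moreover have "1 / 4 * envelope n d - 6912 / (real n * sqrt (real n)) \<le> fair_binom_dvd n d"
      using that by (intro fair_binom_dvd_ge_envelope) auto
    moreover have "0 \<le> 1 / (real n * sqrt (real n))"
      by simp
    ultimately have "l * envelope n d - fair_binom_dvd n d \<le> 6912 / (real n * sqrt (real n))"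
      "0 \<le> 6912 / (real n * sqrt (real n))"
      by (linarith, simp)
    then have "\<bar>fair_binom_dvd n d - E n d\<bar> \<le> 6912 * (1 / (real n * sqrt (real n)))"
      unfolding E_def by (simp add: max_def abs_if)
    also have "\<dots> \<le> 6912 * (8 * (ln (real n) powr (5 / 2) / real n powr (3 / 2)))"
      by (intro mult_left_mono inverse_three_halves_le_log that) simp
    finally show ?thesis by simp
  qed
  have ratio: "l \<le> E n d / envelope n d \<and> E n d / envelope n d \<le> 32 / sqrt (2 * pi)"
    if "2 \<le> d" "d \<le> n" for n d
  proof -
    have pos: "0 < envelope n d"
      using that by (intro envelope_pos) simp
    have "fair_binom_dvd n d \<le> 8 * envelope n d"
      using that by (intro fair_binom_dvd_le_envelope) auto
    moreover have "l * envelope n d \<le> 8 * envelope n d"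
      using l(2) pos by (intro mult_right_mono) auto
    ultimately have "E n d / envelope n d \<le> 8"
      using pos by (simp add: E_def pos_divide_le_eq)
    with u have "E n d / envelope n d \<le> 32 / sqrt (2 * pi)"
      by linarith
    moreover have "l \<le> E n d / envelope n d"
      using pos by (simp add: E_def pos_le_divide_eq)
    ultimately show ?thesis by simp
  qed
  show ?thesis
  proof (rule exI[of _ E], rule exI[of _ "55296 :: real"], intro conjI allI impI)
    fix M :: "'a measure" and \<epsilon> :: "nat \<Rightarrow> 'a \<Rightarrow> int" and n :: nat
    assume bits: "iid_fair_bits M \<epsilon>" and n: "2 \<le> n"
    show "(SUP d\<in>{2..n}. \<bar>measure M {\<omega> \<in> space M. int d dvd partial_sum \<epsilon> n \<omega>} - E n d\<bar>)
        \<le> 55296 * (ln (real n) powr (5 / 2) / real n powr (3 / 2))"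
      using n by (intro cSUP_least) (auto simp: prob_dvd_partial_sum[OF bits] simp del: times_divide_eq_right intro!: error)
  qed (use ratio in \<open>auto simp: envelope_def l_def\<close>)
qed

end
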